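(* Let $D$ be a source-free break digraph on $n$ vertices with $V(D)=S\,\dot\cup\,T$, where $D[S]$ is acyclic and $D[T]$ is a tournament. Suppose that $D[S]$ has an out-kernel $K$ such that $$|K|+1\le \frac n2.$$ Then $D$ has a quasi-kernel $Q$ with $|Q|\le n/2$. Moreover, if in addition $T\subseteq N_D^+[K]$, then the weaker assumption $|K|\le n/2$ (in place of $|K|+1\le n/2$) suffices for the same conclusion.
   Context: All digraphs are finite and loopless. An oriented graph is a digraph with no pair of opposite arcs; a tournament is an orientation of a complete graph; a digraph is acyclic if it has no directed cycle; $D[X]$ denotes the subdigraph of $D$ induced by $X$. An oriented graph $D$ is a break digraph if its vertex set can be partitioned as $V(D)=S\,\dot\cup\,T$ such that $D[S]$ is acyclic and $D[T]$ is a tournament. A vertex is a source if it has no in-neighbor; a digraph is source-free if it has no source. For $X\subseteq V(D)$, $N_D^+[X]=X\cup\{u\in V(D)\setminus X : xu\in A(D)\text{ for some }x\in X\}$, where $A(D)$ is the arc set. A set of vertices is independent if there is no arc between any two of its vertices. An out-kernel of a digraph $D$ is an independent set $K\subseteq V(D)$ with $V(D)=N_D^+[K]$. A quasi-kernel of a digraph $D$ is an independent set $Q\subseteq V(D)$ such that every vertex of $D$ is reachable from some vertex of $Q$ by a directed path of length at most $2$ (length $0$ allowed). *)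

theory Defs
  imports Complex_Main "Graph_Theory.Graph_Theory"
begin

text \<open>
  Digraphs are those of the locale \<^locale>\<open>digraph\<close>: finite, without loops and
  without parallel arcs. The null digraph is allowed.
\<close>

locale oriented_graph = digraph +
  assumes no_opposite_arcs: "u \<rightarrow>\<^bsub>G\<^esub> v \<Longrightarrow> \<not> v \<rightarrow>\<^bsub>G\<^esub> u"

locale tournament = oriented_graph +
  assumes all_adjacent:
    "\<lbrakk>u \<in> verts G; v \<in> verts G; u \<noteq> v\<rbrakk> \<Longrightarrow> u \<rightarrow>\<^bsub>G\<^esub> v \<or> v \<rightarrow>\<^bsub>G\<^esub> u"

definition acyclic_digraph :: "('a,'b) pre_digraph \<Rightarrow> bool" where
  "acyclic_digraph G \<longleftrightarrow> \<not> (\<exists>p. pre_digraph.cycle G p)"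

definition break_partition :: "('a,'b) pre_digraph \<Rightarrow> 'a set \<Rightarrow> 'a set \<Rightarrow> bool" where
  "break_partition G S T \<longleftrightarrow>
     verts G = S \<union> T \<and> S \<inter> T = {} \<and> acyclic_digraph (G \<restriction> S) \<and> tournament (G \<restriction> T)"

definition break_digraph :: "('a,'b) pre_digraph \<Rightarrow> bool" where
  "break_digraph G \<longleftrightarrow> oriented_graph G \<and> (\<exists>S T. break_partition G S T)"

definition source :: "('a,'b) pre_digraph \<Rightarrow> 'a \<Rightarrow> bool" where
  "source G v \<longleftrightarrow> v \<in> verts G \<and> \<not> (\<exists>u. u \<rightarrow>\<^bsub>G\<^esub> v)"

definition source_free :: "('a,'b) pre_digraph \<Rightarrow> bool" where
  "source_free G \<longleftrightarrow> \<not> (\<exists>v. source G v)"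

definition closed_out_nbhd :: "('a,'b) pre_digraph \<Rightarrow> 'a set \<Rightarrow> 'a set" where
  "closed_out_nbhd G X = X \<union> {u \<in> verts G - X. \<exists>x\<in>X. x \<rightarrow>\<^bsub>G\<^esub> u}"

definition independent_set :: "('a,'b) pre_digraph \<Rightarrow> 'a set \<Rightarrow> bool" where
  "independent_set G X \<longleftrightarrow> X \<subseteq> verts G \<and> (\<forall>u\<in>X. \<forall>v\<in>X. \<not> u \<rightarrow>\<^bsub>G\<^esub> v)"

definition out_kernel :: "('a,'b) pre_digraph \<Rightarrow> 'a set \<Rightarrow> bool" where
  "out_kernel G K \<longleftrightarrow> independent_set G K \<and> verts G = closed_out_nbhd G K"

text \<open>A path is given by its list of arcs, so \<^term>\<open>length p\<close> is its length.\<close>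

definition quasi_kernel :: "('a,'b) pre_digraph \<Rightarrow> 'a set \<Rightarrow> bool" where
  "quasi_kernel G Q \<longleftrightarrow> independent_set G Q \<and>
     (\<forall>v\<in>verts G. \<exists>q\<in>Q. \<exists>p. pre_digraph.apath G q p v \<and> length p \<le> 2)"

end

theory Submission
  imports Defs
begin

text \<open>
  If \<open>K\<close> does not dominate all of \<open>T\<close>, let \<open>r\<close> be a king of the tournament induced on
  the undominated part \<open>R\<close> of \<open>T\<close>, and take \<open>Q = {r} \<union> (K - N\<^sup>+(r))\<close>. This set is
  independent since no vertex of \<open>K\<close> dominates \<open>r\<close>. A vertex dominated by some \<open>k \<in> K\<close>
  remains within distance two of \<open>Q\<close>, because a discarded \<open>k\<close> is an out-neighbour of \<open>r\<close>.
\<close>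

text \<open>Adding a vertex \<open>x\<close> either preserves the old king \<open>r\<close>, when
  \<open>r\<close> reaches \<open>x\<close> in at most two steps, or makes \<open>x\<close> itself a
  king.\<close>

lemma king_exists:
  assumes "finite R" "R \<noteq> {}"
    and "\<And>u v. \<lbrakk>u \<in> R; v \<in> R; u \<noteq> v\<rbrakk> \<Longrightarrow> E u v \<or> E v u"
  obtains r where "r \<in> R" "\<And>v. v \<in> R \<Longrightarrow> v = r \<or> E r v \<or> (\<exists>w\<in>R. E r w \<and> E w v)"
proof -
  have "\<exists>r\<in>R. \<forall>v\<in>R. v = r \<or> E r v \<or> (\<exists>w\<in>R. E r w \<and> E w v)"
    using assms
  proof (induction R rule: finite_ne_induct)
    case (singleton x)
    then show ?case by simp
  next
    case (insert x R)
    then obtain r where r: "r \<in> R" "\<forall>v\<in>R. v = r \<or> E r v \<or> (\<exists>w\<in>R. E r w \<and> E w v)"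
      by (metis insertCI)
    show ?case
    proof (cases "E r x \<or> (\<exists>w\<in>R. E r w \<and> E w x)")
      case True
      with r show ?thesis by blast
    next
      case False
      \<comment> \<open>Since \<open>r\<close> cannot reach \<open>x\<close> within two steps,
        neither \<open>r\<close> nor any out-neighbour of \<open>r\<close> points to
        \<open>x\<close>, so by adjacency \<open>x\<close> points to all of them. Every other vertex
        of \<open>R\<close> is an out-neighbour of one of these, hence two steps from
        \<open>x\<close>.\<close>
      have to_x: "E x w" if "w \<in> R" "w = r \<or> E r w" for w
        using that False insert.hyps insert.prems[of x w] by auto
      have "v = x \<or> E x v \<or> (\<exists>w\<in>insert x R. E x w \<and> E w v)" if "v \<in> insert x R" for v
        using that r to_x by blast
      then show ?thesis by blast
    qed
  qed
  with that show thesis by blast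
qed

lemma dominates_induce_subgraph_iff:
  "u \<rightarrow>\<^bsub>G \<restriction> S\<^esub> v \<longleftrightarrow> u \<in> S \<and> v \<in> S \<and> u \<rightarrow>\<^bsub>G\<^esub> v"
  by (auto simp: arcs_ends_def arc_to_ends_def)

context loopfree_digraph
begin

lemma apath_length_le_2:
  assumes "v \<in> verts G" "v = q \<or> q \<rightarrow>\<^bsub>G\<^esub> v \<or> (\<exists>w. q \<rightarrow>\<^bsub>G\<^esub> w \<and> w \<rightarrow>\<^bsub>G\<^esub> v)"
  shows "\<exists>p. apath q p v \<and> length p \<le> 2"
proof -
  \<comment> \<open>An \<open>apath\<close> must not repeat vertices. Absence of loops separates
    consecutive vertices, but a walk of length two could return to its start, so
    \<open>v = q\<close> is split off and served by the empty path.\<close>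
  consider "v = q" | "v \<noteq> q" "q \<rightarrow>\<^bsub>G\<^esub> v" | w where "v \<noteq> q" "q \<rightarrow>\<^bsub>G\<^esub> w" "w \<rightarrow>\<^bsub>G\<^esub> v"
    using assms(2) by blast
  then show ?thesis
  proof cases
    case 1
    with assms(1) have "apath q [] v" by (simp add: apath_Nil_iff)
    then show ?thesis by (intro exI[of _ "[]"]) simp
  next
    case 2
    then obtain e where "e \<in> arcs G" "tail G e = q" "head G e = v" by auto
    with 2 have "apath q [e] v" by (auto simp: apath_def awalk_simps)
    then show ?thesis by (intro exI[of _ "[e]"]) simp
  next
    case 3
    obtain e where "e \<in> arcs G" "tail G e = q" "head G e = w"
      using \<open>q \<rightarrow>\<^bsub>G\<^esub> w\<close> by auto
    moreover obtain f where "f \<in> arcs G" "tail G f = w" "head G f = v"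
      using \<open>w \<rightarrow>\<^bsub>G\<^esub> v\<close> by auto
    ultimately have "apath q [e, f] v"
      using 3 no_loops[of e] no_loops[of f]
      by (auto simp: apath_def awalk_simps)
    then show ?thesis by (intro exI[of _ "[e, f]"]) simp
  qed
qed

lemma quasi_kernelI:
  assumes "independent_set G Q"
    and "\<And>v. v \<in> verts G \<Longrightarrow>
      \<exists>q\<in>Q. v = q \<or> q \<rightarrow>\<^bsub>G\<^esub> v \<or> (\<exists>w. q \<rightarrow>\<^bsub>G\<^esub> w \<and> w \<rightarrow>\<^bsub>G\<^esub> v)"
  shows "quasi_kernel G Q"
  using assms apath_length_le_2 unfolding quasi_kernel_def by meson

end

context digraph
begin

lemma out_kernel_imp_quasi_kernel:
  assumes "out_kernel G K"
  shows "quasi_kernel G K"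
  using assms by (intro quasi_kernelI) (auto simp: out_kernel_def closed_out_nbhd_def)

lemma quasi_kernel_insert_king:
  assumes K: "independent_set G K"
    and r: "r \<in> verts G - closed_out_nbhd G K"
    and king: "\<And>v. v \<in> verts G - closed_out_nbhd G K \<Longrightarrow>
      v = r \<or> r \<rightarrow>\<^bsub>G\<^esub> v \<or> (\<exists>w. r \<rightarrow>\<^bsub>G\<^esub> w \<and> w \<rightarrow>\<^bsub>G\<^esub> v)"
  shows "quasi_kernel G (insert r {k \<in> K. \<not> r \<rightarrow>\<^bsub>G\<^esub> k})"
proof (rule quasi_kernelI)
  show "independent_set G (insert r {k \<in> K. \<not> r \<rightarrow>\<^bsub>G\<^esub> k})"
    \<comment> \<open>Arcs from \<open>r\<close> into the kept part of \<open>K\<close> are removed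
      by the filter; arcs from \<open>K\<close> to \<open>r\<close> would put \<open>r\<close> into
      the closed neighbourhood of \<open>K\<close>.\<close>
    using K r adj_not_same by (auto simp: independent_set_def closed_out_nbhd_def)
next
  fix v assume "v \<in> verts G"
  then consider "v \<in> verts G - closed_out_nbhd G K" | k where "k \<in> K" "v = k \<or> k \<rightarrow>\<^bsub>G\<^esub> v"
    by (auto simp: closed_out_nbhd_def)
  then show "\<exists>q\<in>insert r {k \<in> K. \<not> r \<rightarrow>\<^bsub>G\<^esub> k}.
      v = q \<or> q \<rightarrow>\<^bsub>G\<^esub> v \<or> (\<exists>w. q \<rightarrow>\<^bsub>G\<^esub> w \<and> w \<rightarrow>\<^bsub>G\<^esub> v)"
  proof cases
    case 1
    with king show ?thesis by blast
  next
    case 2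
    then show ?thesis by (cases "r \<rightarrow>\<^bsub>G\<^esub> k") auto
  qed
qed

end

theorem theorem5p3:
  fixes D :: "('a,'b) pre_digraph" and S T K :: "'a set" and n :: nat
  assumes "break_digraph D"
    and "source_free D"
    and "n = card (verts D)"
    and "break_partition D S T"
    and "out_kernel (D \<restriction> S) K"
  shows "(real (card K) + 1 \<le> real n / 2 \<longrightarrow>
            (\<exists>Q. quasi_kernel D Q \<and> real (card Q) \<le> real n / 2)) \<and>
         (T \<subseteq> closed_out_nbhd D K \<and> real (card K) \<le> real n / 2 \<longrightarrow>
            (\<exists>Q. quasi_kernel D Q \<and> real (card Q) \<le> real n / 2))"
proof -
  interpret oriented_graph D
    using assms(1) by (simp add: break_digraph_def)
  have vD: "verts D = S \<union> T" and tour: "tournament (D \<restriction> T)"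
    using assms(4) by (auto simp: break_partition_def)
  \<comment> \<open>Here \<open>K\<close> lies in \<open>S\<close>, and \<open>D\<close> and
    \<open>D \<restriction> S\<close> have the same adjacencies inside \<open>S\<close>, so
    independence and domination of \<open>S\<close> carry over to \<open>D\<close>.\<close>
  have K: "independent_set D K"
    using assms(5) vD unfolding out_kernel_def independent_set_def
      dominates_induce_subgraph_iff induce_subgraph_verts by blast
  have S: "S \<subseteq> closed_out_nbhd D K"
    using assms(5) vD unfolding out_kernel_def closed_out_nbhd_def
      dominates_induce_subgraph_iff induce_subgraph_verts by blast
  have finK: "finite K"
    using K finite_subset[OF _ finite_verts] by (simp add: independent_set_def)
  define R where "R = verts D - closed_out_nbhd D K"
  \<comment> \<open>This gives the second claim with \<open>K\<close> itself as witness, and also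
    the case \<open>R = {}\<close> below.\<close>
  have dominating: "quasi_kernel D K" if "T \<subseteq> closed_out_nbhd D K"
  proof (rule out_kernel_imp_quasi_kernel)
    show "out_kernel D K"
      using that S K vD by (auto simp: out_kernel_def independent_set_def closed_out_nbhd_def)
  qed
  \<comment> \<open>The extra 1 pays for the king \<open>r\<close>.\<close>
  have "\<exists>Q. quasi_kernel D Q \<and> card Q \<le> card K + 1"
  proof (cases "R = {}")
    case True
    then have "T \<subseteq> closed_out_nbhd D K"
      using vD by (auto simp: R_def)
    with dominating show ?thesis by auto
  next
    case False
    \<comment> \<open>All of \<open>S\<close> is dominated by \<open>K\<close>, so undominated
      vertices lie in \<open>T\<close> and are pairwise adjacent.\<close>
    have "R \<subseteq> T" using S vD by (auto simp: R_def)
    then have adjacent: "u \<rightarrow>\<^bsub>D\<^esub> v \<or> v \<rightarrow>\<^bsub>D\<^esub> u" if "u \<in> R" "v \<in> R" "u \<noteq> v" for u v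
      using that tournament.all_adjacent[OF tour, of u v]
      by (auto simp: dominates_induce_subgraph_iff)
    have "finite R" by (simp add: R_def)
    then obtain r where r: "r \<in> R"
      and king: "\<And>v. v \<in> R \<Longrightarrow> v = r \<or> r \<rightarrow>\<^bsub>D\<^esub> v \<or> (\<exists>w\<in>R. r \<rightarrow>\<^bsub>D\<^esub> w \<and> w \<rightarrow>\<^bsub>D\<^esub> v)"
      using king_exists[of R "\<lambda>u v. u \<rightarrow>\<^bsub>D\<^esub> v"] False adjacent by blast
    let ?Q = "insert r {k \<in> K. \<not> r \<rightarrow>\<^bsub>D\<^esub> k}"
    have "quasi_kernel D ?Q"
      using K r king unfolding R_def by (intro quasi_kernel_insert_king) blast+
    moreover have "card ?Q \<le> card (insert r K)"
      using finK by (intro card_mono) auto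
    then have "card ?Q \<le> card K + 1"
      using finK by (simp add: card_insert_if split: if_splits)
    ultimately show ?thesis by blast
  qed
  then obtain Q where Q: "quasi_kernel D Q" and card_Q: "card Q \<le> card K + 1" by blast
  have "real (card Q) \<le> real (card K) + 1"
    using card_Q by linarith
  with Q dominating show ?thesis
    by (meson order_trans)
qed

end
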